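(* Let $A$ and $B$ be integer $6\times 6$ matrices, each symplectic with respect to some integer non-degenerate skew-symmetric matrix (that is, $A^\top J_A A=J_A$ and $B^\top J_B B=J_B$ for some such $J_A,J_B$). Suppose that each of $A$ and $B$ has only simple eigenvalues, with exactly two eigenvalues outside the unit circle, two inside it, and two complex conjugate eigenvalues on it, so that the induced automorphisms $f_A,f_B$ of $\mathbb{T}^6$ are partially hyperbolic with two-dimensional unstable and stable foliations. Suppose also that $f_A$ and $f_B$ are transitive. Then $f_A$ and $f_B$ are topologically conjugate if and only if the matrices $A$ and $B$ are integrally similar.
   Context: $\mathbb{T}^6=\mathbb{R}^6/\mathbb{Z}^6$ is the standard torus and $p:\mathbb{R}^6\to\mathbb{T}^6$ is the quotient homomorphism. An integer matrix $A$ with $\det A=\pm1$ defines the linear map $L_A:x\mapsto Ax$ of $\mathbb{R}^6$, which preserves $\mathbb{Z}^6$ and hence induces a diffeomorphism (group automorphism) $f_A$ of $\mathbb{T}^6$ with $f_A\circ p=p\circ L_A$. A matrix $A$ satisfying $A^\top JA=J$ with $J$ integer, skew-symmetric and non-degenerate is automatically unimodular. The matrix $J$ may be the standard symplectic matrix or a non-standard one. A symplectic integer matrix generates a partially hyperbolic automorphism of the torus if it has eigenvalues both off and on the unit circle. The unstable (respectively stable) foliation of $f_A$ has as leaves the projections by $p$ of the translates in $\mathbb{R}^6$ of the real $L_A$-invariant subspace corresponding to the eigenvalues outside (respectively inside) the unit circle. A diffeomorphism $f$ of $\mathbb{T}^6$ is transitive if for any two nonempty open sets $U,V\subset\mathbb{T}^6$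 there is $m\in\mathbb{Z}$ with $f^m(U)\cap V\ne\emptyset$. Two homeomorphisms $f_1,f_2$ of $\mathbb{T}^6$ are topologically conjugate if there is a homeomorphism $h:\mathbb{T}^6\to\mathbb{T}^6$ with $h\circ f_1=f_2\circ h$. Two integer matrices $A,B$ are integrally similar if there is an integer unimodular matrix $H$ ($\det H=\pm1$) with $HA=BH$. *)

theory Defs
  imports "HOL-Analysis.Analysis" "HOL-Computational_Algebra.Polynomial"
begin

definition lattice_cong :: "real^'n::finite \<Rightarrow> real^'n \<Rightarrow> bool" where
  "lattice_cong x y \<longleftrightarrow> (\<forall>i. (x - y) $ i \<in> \<int>)"

lemma lattice_cong_equivp: "equivp lattice_cong"
proof (rule equivpI)
  show "reflp (lattice_cong :: real^'n \<Rightarrow> _)"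
    by (simp add: reflp_def lattice_cong_def)
  show "symp (lattice_cong :: real^'n \<Rightarrow> _)"
    unfolding symp_def lattice_cong_def
    by (metis Ints_minus minus_diff_eq vector_uminus_component)
  show "transp (lattice_cong :: real^'n \<Rightarrow> _)"
    unfolding transp_def lattice_cong_def
  proof (intro allI impI)
    fix x y z :: "real^'n" and i
    assume "\<forall>i. (x - y) $ i \<in> \<int>" "\<forall>i. (y - z) $ i \<in> \<int>"
    then have "(x - y) $ i + (y - z) $ i \<in> \<int>"
      by (intro Ints_add) auto
    then show "(x - z) $ i \<in> \<int>"
      by simp
  qed
qed

quotient_type (overloaded) 'n torus = "real^'n::finite" / lattice_cong
  by (rule lattice_cong_equivp)

abbreviation torus_proj :: "real^'n::finite \<Rightarrow> 'n torus" where
  "torus_proj \<equiv> abs_torus"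

instantiation torus :: (finite) topological_space
begin

definition open_torus :: "'a torus set \<Rightarrow> bool" where
  "open_torus U \<longleftrightarrow> open (torus_proj -` U)"

instance
  by standard (simp_all add: open_torus_def vimage_Union open_Int open_UN)

end

definition lin_map :: "int^'n^'n \<Rightarrow> real^'n \<Rightarrow> real^'n::finite" where
  "lin_map A x = map_matrix real_of_int A *v x"

lemma lin_map_lattice_cong:
  "lattice_cong x y \<Longrightarrow> lattice_cong (lin_map A x) (lin_map A y)"
  unfolding lattice_cong_def lin_map_def
  by (simp flip: matrix_vector_mult_diff_distrib)
     (auto simp: matrix_vector_mult_def intro!: Ints_sum Ints_mult)

lift_definition torus_map :: "int^'n^'n \<Rightarrow> 'n torus \<Rightarrow> 'n::finite torus" is lin_map
  by (rule lin_map_lattice_cong)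

lemma torus_map_comp_proj: "torus_map A \<circ> torus_proj = torus_proj \<circ> lin_map A"
  by (simp add: fun_eq_iff torus_map.abs_eq)

definition char_matrix_poly :: "complex^'n^'n \<Rightarrow> complex poly" where
  "char_matrix_poly M = det (mat (monom 1 1) - map_matrix (\<lambda>c. [:c:]) M)"

definition is_eigenvalue :: "complex^'n^'n \<Rightarrow> complex \<Rightarrow> bool" where
  "is_eigenvalue M z \<longleftrightarrow> (\<exists>v. v \<noteq> 0 \<and> M *v v = z *s v)"

definition eigenvalues :: "int^'n^'n \<Rightarrow> complex set" where
  "eigenvalues A = {z. is_eigenvalue (map_matrix of_int A) z}"

definition simple_eigenvalues :: "int^'n^'n \<Rightarrow> bool" where
  "simple_eigenvalues A \<longleftrightarrow>
     (\<forall>z\<in>eigenvalues A. order z (char_matrix_poly (map_matrix of_int A)) = 1)"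

definition symplectic_wrt :: "int^'n^'n \<Rightarrow> int^'n^'n \<Rightarrow> bool" where
  "symplectic_wrt J A \<longleftrightarrow>
     transpose J = - J \<and> det J \<noteq> 0 \<and> transpose A ** J ** A = J"

text \<open>Eigenvalues are counted without multiplicity here; the count is only used
  together with \<^const>\<open>simple_eigenvalues\<close>.\<close>

definition two_two_two_spectrum :: "int^'n^'n \<Rightarrow> bool" where
  "two_two_two_spectrum A \<longleftrightarrow>
     card {z \<in> eigenvalues A. cmod z > 1} = 2 \<and>
     card {z \<in> eigenvalues A. cmod z < 1} = 2 \<and>
     (\<exists>w. w \<noteq> cnj w \<and> {z \<in> eigenvalues A. cmod z = 1} = {w, cnj w})"

text \<open>Meaningful for bijective \<^term>\<open>f\<close>. A symplectic \<^term>\<open>A\<close> is unimodular,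
  so \<^term>\<open>torus_map A\<close> is bijective.\<close>

definition int_iterate :: "('a \<Rightarrow> 'a) \<Rightarrow> int \<Rightarrow> 'a \<Rightarrow> 'a" where
  "int_iterate f m = (if m \<ge> 0 then f ^^ nat m else inv f ^^ nat (- m))"

definition topologically_transitive :: "('a::topological_space \<Rightarrow> 'a) \<Rightarrow> bool" where
  "topologically_transitive f \<longleftrightarrow>
     (\<forall>U V. open U \<and> U \<noteq> {} \<and> open V \<and> V \<noteq> {} \<longrightarrow>
        (\<exists>m. int_iterate f m ` U \<inter> V \<noteq> {}))"

definition topologically_conjugate ::
    "('a::topological_space \<Rightarrow> 'a) \<Rightarrow> ('a \<Rightarrow> 'a) \<Rightarrow> bool" where
  "topologically_conjugate f1 f2 \<longleftrightarrow>
     (\<exists>h h'. homeomorphism UNIV UNIV h h' \<and> h \<circ> f1 = f2 \<circ> h)"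

definition integrally_similar :: "int^'n^'n \<Rightarrow> int^'n^'n \<Rightarrow> bool" where
  "integrally_similar A B \<longleftrightarrow>
     (\<exists>H :: int^'n^'n. (det H = 1 \<or> det H = -1) \<and> H ** A = B ** H)"

end

theory Submission
  imports Defs
begin

text \<open>
  The equivalence holds for any two integer matrices of the same size; it rests on the action of
  a torus map on the fundamental group \<open>\<int>\<^sup>n\<close>, made concrete through lifts to the universal cover.

  A continuous map \<open>f\<close> of the torus lifts to a continuous map \<open>F\<close> of \<open>\<real>\<^sup>n\<close>
  (\<open>continuous_map_to_torus_lifts\<close>), and two lifts of one map differ by a constant lattice
  vector (\<open>lifts_differ_by_lattice_vector\<close>).  Comparing \<open>F\<close> with its translates
  \<open>F (x + n)\<close> yields an integer matrix \<open>N\<close> with \<open>F (x + n) = F x + N n\<close>.  This matrix depends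
  only on \<open>f\<close>, turns composition into matrix multiplication, and equals \<open>A\<close> when \<open>f\<close> is
  the map induced by \<open>A\<close>.  Hence a homeomorphism \<open>h\<close> has a unimodular matrix \<open>N\<close>, and
  \<open>h \<circ> f\<^sub>A = f\<^sub>B \<circ> h\<close> becomes \<open>N A = B N\<close>.

  Conversely, a unimodular \<open>H\<close> with \<open>H A = B H\<close> has an integer inverse, by Cramer's rule, so it
  induces a homeomorphism of the torus, which conjugates \<open>f\<^sub>A\<close> to \<open>f\<^sub>B\<close>.
\<close>

section \<open>The torus as a quotient of Euclidean space\<close>

text \<open>The inclusion of the lattice of integer vectors in Euclidean space.\<close>

definition real_vec :: "int^'n \<Rightarrow> real^'n::finite" where
  "real_vec n = (\<chi> i. real_of_int (n $ i))"

lemma real_vec_nth [simp]: "real_vec n $ i = real_of_int (n $ i)"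
  by (simp add: real_vec_def)

lemma real_vec_add: "real_vec (m + n) = real_vec m + real_vec n"
  by (simp add: vec_eq_iff)

lemma real_vec_inject [simp]: "real_vec m = real_vec n \<longleftrightarrow> m = n"
  by (simp add: vec_eq_iff)

lemma torus_proj_eq_iff: "torus_proj x = torus_proj y \<longleftrightarrow> lattice_cong x y"
  using torus.abs_eq_iff by blast

lemma lattice_cong_iff: "lattice_cong x y \<longleftrightarrow> (\<exists>n. x = y + real_vec n)"
proof
  assume "lattice_cong x y"
  then have "\<forall>i. \<exists>m. (x - y) $ i = real_of_int m"
    unfolding lattice_cong_def Ints_def by blast
  then obtain k where "\<And>i. (x - y) $ i = real_of_int (k i)"
    by metis
  then have "x = y + real_vec (\<chi> i. k i)"
    by (simp add: vec_eq_iff algebra_simps)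
  then show "\<exists>n. x = y + real_vec n" ..
qed (auto simp: lattice_cong_def)

lemma torus_proj_add_real_vec [simp]: "torus_proj (x + real_vec n) = torus_proj x"
  by (auto simp: torus_proj_eq_iff lattice_cong_iff)

lemma torus_proj_surj: obtains y where "t = torus_proj y"
  by (metis Quotient3_abs_rep Quotient3_torus)

text \<open>The universal property of the quotient topology.\<close>

lemma continuous_on_torus_iff:
  "continuous_on UNIV f \<longleftrightarrow> continuous_on UNIV (\<lambda>x. f (torus_proj x))"
  by (simp add: continuous_on_open_vimage open_torus_def vimage_def)

lemma continuous_on_torus_proj: "continuous_on UNIV (torus_proj :: real^'n::finite \<Rightarrow> _)"
  using continuous_on_torus_iff[of "id :: 'n torus \<Rightarrow> _"] by simp

lemma lattice_cong_iff_cis: "lattice_cong x y \<longleftrightarrow> (\<forall>i. cis (2 * pi * x $ i) = cis (2 * pi * y $ i))"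
proof -
  have "(a - b \<in> \<int>) \<longleftrightarrow> cis (2 * pi * a) = cis (2 * pi * b)" for a b :: real
  proof -
    have "cis (2 * pi * a) = cis (2 * pi * b) \<longleftrightarrow> cis (2 * pi * a) / cis (2 * pi * b) = 1"
      by simp
    also have "\<dots> \<longleftrightarrow> cis (2 * pi * (a - b)) = 1"
      by (simp add: cis_divide algebra_simps)
    also have "\<dots> \<longleftrightarrow> (\<exists>n::int. 2 * pi * (a - b) = of_int (2 * n) * pi)"
      by (simp add: cis_conv_exp exp_eq_1)
    also have "\<dots> \<longleftrightarrow> (\<exists>n::int. a - b = of_int n)"
    proof -
      have "2 * pi * (a - b) = of_int (2 * n) * pi \<longleftrightarrow> a - b = of_int n" for n :: int
      proof -
        have "2 * pi * (a - b) = of_int (2 * n) * pi \<longleftrightarrow> (2 * pi) * (a - b) = (2 * pi) * of_int n"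
          by (simp add: mult_ac)
        also have "\<dots> \<longleftrightarrow> a - b = of_int n"
          by (subst mult_cancel_left) simp
        finally show ?thesis .
      qed
      then show ?thesis by simp
    qed
    finally show ?thesis by (auto simp: Ints_def)
  qed
  then show ?thesis by (simp add: lattice_cong_def)
qed

text \<open>The \<open>i\<close>-th coordinate of a point of the torus, seen on the unit circle of the complex plane.\<close>

lift_definition torus_coord :: "'n::finite \<Rightarrow> 'n torus \<Rightarrow> complex" is "\<lambda>i x. cis (2 * pi * x $ i)"
  by (simp add: lattice_cong_iff_cis)

lemma torus_coord_proj: "torus_coord i (torus_proj x) = cis (2 * pi * x $ i)"
  by (rule torus_coord.abs_eq)

lemma continuous_on_torus_coord: "continuous_on UNIV (torus_coord i)"
  unfolding continuous_on_torus_iff torus_coord_proj by (intro continuous_intros continuous_on_component)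

lemma norm_torus_coord: "norm (torus_coord i t) = 1"
  by transfer simp

section \<open>Lifting to the universal cover\<close>

text \<open>The lift is found coordinate by coordinate: the domain is contractible, so each
  circle-valued coordinate of \<open>f\<close> has a continuous real argument.\<close>

lemma continuous_map_to_torus_lifts:
  fixes f :: "'a::real_normed_vector \<Rightarrow> 'n::finite torus"
  assumes "continuous_on UNIV f"
  obtains F where "continuous_on UNIV F" "\<And>x. torus_proj (F x) = f x"
proof -
  have "\<exists>g. continuous_on UNIV g \<and> (\<forall>x. torus_coord i (f x) = cis (g x))" for i
  proof -
    have "continuous_on UNIV (\<lambda>x. torus_coord i (f x))"
      by (rule continuous_on_compose2[OF continuous_on_torus_coord assms]) simp
    moreover have "(\<lambda>x. torus_coord i (f x)) \<in> UNIV \<rightarrow> sphere 0 1"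
      by (simp add: norm_torus_coord)
    ultimately obtain c where
      "homotopic_with_canon (\<lambda>h. True) UNIV (sphere 0 1) (\<lambda>x. torus_coord i (f x)) (\<lambda>x. c)"
      using nullhomotopic_from_contractible[OF _ _ contractible_UNIV] by metis
    then show ?thesis
      using inessential_eq_continuous_logarithm_circle[of UNIV "\<lambda>x. torus_coord i (f x)"]
      by (auto simp: cis_conv_exp)
  qed
  then obtain g where g: "\<And>i. continuous_on UNIV (g i)"
      "\<And>i x. torus_coord i (f x) = cis (g i x)"
    by metis
  define F where "F x = (\<chi> i. g i x / (2 * pi))" for x
  show thesis
  proof
    show "continuous_on UNIV F"
      unfolding F_def by (intro continuous_intros g) simp
    show "torus_proj (F x) = f x" for x
    proof -
      obtain y where y: "f x = torus_proj y" by (rule torus_proj_surj)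
      have "cis (2 * pi * F x $ i) = cis (2 * pi * y $ i)" for i
        using g(2)[of i x] by (simp add: y torus_coord_proj F_def)
      then show ?thesis
        by (simp add: y torus_proj_eq_iff lattice_cong_iff_cis)
    qed
  qed
qed

lemma continuous_on_Ints_constant:
  fixes f :: "'a::real_normed_vector \<Rightarrow> real"
  assumes "continuous_on UNIV f" "\<And>x. f x \<in> \<int>"
  shows "f x = f y"
proof -
  have conn: "connected (range f)"
    using assms(1) connected_UNIV by (rule connected_continuous_image)
  have False if "f a < f b" for a b
  proof -
    obtain m n where mn: "f a = of_int m" "f b = of_int n"
      using assms(2) unfolding Ints_def by blast
    with that have "f a + 1/2 \<in> {f a..f b}" by simp
    moreover have "{f a..f b} \<subseteq> range f"
      by (rule connected_contains_Icc[OF conn]) auto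
    ultimately have "f a + 1/2 \<in> range f" by blast
    then have "f a + 1/2 \<in> \<int>" using assms(2) by (metis rangeE)
    then obtain k where "real_of_int m + 1/2 = of_int k"
      unfolding mn Ints_def by blast
    then have "real_of_int (2 * m + 1) = real_of_int (2 * k)" by simp
    then have "2 * m + 1 = 2 * k" by (rule of_int_eq_iff[THEN iffD1])
    then show False by presburger
  qed
  then show ?thesis by (metis linorder_neqE)
qed

lemma lifts_differ_by_lattice_vector:
  fixes F G :: "'a::real_normed_vector \<Rightarrow> real^'n::finite"
  assumes "continuous_on UNIV F" "continuous_on UNIV G"
    and "\<And>x. torus_proj (F x) = torus_proj (G x)"
  obtains n where "\<And>x. F x = G x + real_vec n"
proof -
  obtain n where n: "F 0 = G 0 + real_vec n"
    using assms(3)[of 0] by (auto simp: torus_proj_eq_iff lattice_cong_iff)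
  have "(F x - G x) $ i = (F 0 - G 0) $ i" for x i
  proof (rule continuous_on_Ints_constant[where f = "\<lambda>x. (F x - G x) $ i"])
    show "continuous_on UNIV (\<lambda>x. (F x - G x) $ i)"
      by (intro continuous_intros continuous_on_component assms)
    show "(F x - G x) $ i \<in> \<int>" for x
      using assms(3)[of x] by (simp add: torus_proj_eq_iff lattice_cong_def)
  qed
  then have "F x = G x + real_vec n" for x
    using n by (simp add: vec_eq_iff algebra_simps)
  then show thesis by (rule that)
qed

lemma additive_int_vec_matrix:
  fixes f :: "int^'n::finite \<Rightarrow> int^'m::finite"
  assumes add: "\<And>x y. f (x + y) = f x + f y"
  obtains N where "\<And>x. f x = N *v x"
proof
  interpret f: additive f by standard (rule add)
  have nat: "f (of_nat k *s x) = of_nat k *s f x" for k x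
    by (induction k) (simp_all add: f.zero add vector_sadd_rdistrib)
  have smult: "f (c *s x) = c *s f x" for c x
    by (cases c rule: int_cases2)
       (simp_all only: nat f.minus vector_smult_lneg)
  fix x
  have "f x = f (\<Sum>j\<in>UNIV. x $ j *s axis j 1)"
    by (simp add: basis_expansion)
  also have "\<dots> = (\<Sum>j\<in>UNIV. x $ j *s f (axis j 1))"
    by (simp add: f.sum smult)
  also have "\<dots> = (\<chi> i j. f (axis j 1) $ i) *v x"
    by (simp add: vec_eq_iff matrix_vector_mult_def mult.commute)
  finally show "f x = (\<chi> i j. f (axis j 1) $ i) *v x" .
qed

section \<open>The integer matrix of a torus map\<close>

text \<open>The matrix \<open>N\<close> describes the action of \<open>f\<close> on the deck group \<open>\<int>\<^sup>n\<close>: some continuous lift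
  \<open>F\<close> of \<open>f\<close> satisfies \<open>F (x + n) = F x + N n\<close> for all lattice vectors \<open>n\<close>.  No base point is
  needed, since lifts differ by translations.\<close>

definition induces_on_lattice :: "('n torus \<Rightarrow> 'n torus) \<Rightarrow> int^'n^'n::finite \<Rightarrow> bool" where
  "induces_on_lattice f N \<longleftrightarrow>
     (\<exists>F. continuous_on UNIV F \<and> (\<forall>x. torus_proj (F x) = f (torus_proj x)) \<and>
          (\<forall>x n. F (x + real_vec n) = F x + real_vec (N *v n)))"

lemma induces_on_lattice_exists:
  fixes f :: "'n::finite torus \<Rightarrow> 'n torus"
  assumes "continuous_on UNIV f"
  obtains N where "induces_on_lattice f N"
proof -
  have "continuous_on UNIV (\<lambda>x. f (torus_proj x))"
    using assms by (simp add: continuous_on_torus_iff)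
  then obtain F where F: "continuous_on UNIV F" "\<And>x. torus_proj (F x) = f (torus_proj x)"
    by (rule continuous_map_to_torus_lifts) auto
  have "\<exists>m. \<forall>x. F (x + real_vec n) = F x + real_vec m" for n
  proof -
    have "continuous_on UNIV (\<lambda>x. F (x + real_vec n))"
      by (rule continuous_on_compose2[OF F(1)]) (auto intro!: continuous_intros)
    then show ?thesis
      by (rule lifts_differ_by_lattice_vector[OF _ F(1)]) (auto simp: F(2))
  qed
  then obtain d where d: "\<And>n x. F (x + real_vec n) = F x + real_vec (d n)"
    by metis
  have "d (m + n) = d m + d n" for m n
  proof -
    have "F 0 + real_vec (d (m + n)) = F (0 + real_vec (m + n))"
      by (rule d[symmetric])
    also have "\<dots> = F (0 + real_vec n + real_vec m)"
      by (simp add: real_vec_add add_ac)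
    also have "\<dots> = F 0 + real_vec (d m + d n)"
      unfolding d by (simp add: real_vec_add add_ac)
    finally show ?thesis by simp
  qed
  then obtain N where "\<And>n. d n = N *v n"
    by (rule additive_int_vec_matrix) blast
  then have "induces_on_lattice f N"
    unfolding induces_on_lattice_def using F d by auto
  then show thesis by (rule that)
qed

lemma induces_on_lattice_unique:
  assumes "induces_on_lattice f M" "induces_on_lattice f N"
  shows "M = N"
proof -
  obtain F where F: "continuous_on UNIV F" "\<And>x. torus_proj (F x) = f (torus_proj x)"
      "\<And>x n. F (x + real_vec n) = F x + real_vec (M *v n)"
    using assms(1) unfolding induces_on_lattice_def by blast
  obtain G where G: "continuous_on UNIV G" "\<And>x. torus_proj (G x) = f (torus_proj x)"
      "\<And>x n. G (x + real_vec n) = G x + real_vec (N *v n)"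
    using assms(2) unfolding induces_on_lattice_def by blast
  obtain c where c: "\<And>x. F x = G x + real_vec c"
    using lifts_differ_by_lattice_vector[OF F(1) G(1)] F(2) G(2) by metis
  have "M *v n = N *v n" for n
  proof -
    have "F 0 + real_vec (M *v n) = F 0 + real_vec (N *v n)"
      using F(3)[of 0 n] G(3)[of 0 n] c[of 0] c[of "0 + real_vec n"] by (simp add: add_ac)
    then show ?thesis by simp
  qed
  then show ?thesis by (simp add: matrix_eq)
qed

lemma induces_on_lattice_comp:
  assumes "induces_on_lattice f M" "induces_on_lattice g N"
  shows "induces_on_lattice (f \<circ> g) (M ** N)"
proof -
  obtain F where F: "continuous_on UNIV F" "\<And>x. torus_proj (F x) = f (torus_proj x)"
      "\<And>x n. F (x + real_vec n) = F x + real_vec (M *v n)"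
    using assms(1) unfolding induces_on_lattice_def by blast
  obtain G where G: "continuous_on UNIV G" "\<And>x. torus_proj (G x) = g (torus_proj x)"
      "\<And>x n. G (x + real_vec n) = G x + real_vec (N *v n)"
    using assms(2) unfolding induces_on_lattice_def by blast
  have "continuous_on UNIV (\<lambda>x. F (G x))"
    by (rule continuous_on_compose2[OF F(1) G(1)]) simp
  then show ?thesis
    unfolding induces_on_lattice_def
    by (intro exI[of _ "\<lambda>x. F (G x)"]) (simp add: F G matrix_vector_mul_assoc)
qed

section \<open>Torus maps induced by integer matrices\<close>

lemma continuous_on_lin_map: "continuous_on S (lin_map A)"
  unfolding lin_map_def by (intro matrix_vector_mult_linear_continuous_on)

lemma lin_map_real_vec: "lin_map A (real_vec n) = real_vec (A *v n)"
  by (simp add: vec_eq_iff lin_map_def matrix_vector_mult_def)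

lemma induces_on_lattice_torus_map: "induces_on_lattice (torus_map A) A"
  unfolding induces_on_lattice_def
  by (intro exI[of _ "lin_map A"])
     (simp add: continuous_on_lin_map torus_map.abs_eq flip: lin_map_real_vec,
      simp add: lin_map_def matrix_vector_right_distrib)

lemma continuous_on_torus_map: "continuous_on UNIV (torus_map A)"
  unfolding continuous_on_torus_iff torus_map.abs_eq
  by (rule continuous_on_compose2[OF continuous_on_torus_proj continuous_on_lin_map]) simp

lemma map_matrix_of_int_mult:
  "map_matrix real_of_int (A ** B) = map_matrix real_of_int A ** map_matrix real_of_int B"
  by (simp add: vec_eq_iff matrix_matrix_mult_def)

lemma map_matrix_of_int_one: "map_matrix real_of_int (mat 1) = mat 1"
  by (simp add: vec_eq_iff mat_def)

lemma lin_map_mult: "lin_map (A ** B) x = lin_map A (lin_map B x)"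
  by (simp add: lin_map_def map_matrix_of_int_mult matrix_vector_mul_assoc)

lemma torus_map_mult: "torus_map (A ** B) t = torus_map A (torus_map B t)"
  by (rule torus_proj_surj[of t]) (simp add: torus_map.abs_eq lin_map_mult)

lemma torus_map_one: "torus_map (mat 1) t = t"
  by (rule torus_proj_surj[of t]) (simp add: torus_map.abs_eq lin_map_def map_matrix_of_int_one)

lemma det_map_matrix_of_int: "det (map_matrix real_of_int A) = real_of_int (det A)"
  by (simp add: det_def)

lemma int_matrix_unimodular_inverse:
  fixes H :: "int^'n::finite^'n"
  assumes "det H = 1 \<or> det H = - 1"
  obtains G where "H ** G = mat 1" "G ** H = mat 1"
proof -
  define R where "R = map_matrix real_of_int H"
  \<comment> \<open>Cramer's rule for column \<open>l\<close> of the inverse; dividing by the determinant, which is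
      \<open>1\<close> or \<open>- 1\<close>, is the same as multiplying by it.\<close>
  define C where "C k l = (\<chi> i j. if j = k then axis l 1 $ i else H $ i $ j)" for k l
  define G where "G = (\<chi> k l. det H * det (C k l))"
  have detR: "det R = 1 \<or> det R = -1"
    using assms by (auto simp: R_def det_map_matrix_of_int)
  have "R *v column l (map_matrix real_of_int G) = axis l 1" for l
  proof -
    let ?C = "\<lambda>k. \<chi> i j. if j = k then (axis l 1 :: real^'n) $ i else R $ i $ j"
    have "map_matrix real_of_int (C k l) = ?C k" for k
      by (simp add: vec_eq_iff C_def R_def axis_def)
    then have det_C: "det (?C k) = real_of_int (det (C k l))" for k
      by (metis det_map_matrix_of_int)
    have "column l (map_matrix real_of_int G) $ k = det (?C k) / det R" for k
      using assms unfolding det_C by (auto simp: column_def G_def R_def det_map_matrix_of_int)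
    then have "column l (map_matrix real_of_int G) = (\<chi> k. det (?C k) / det R)"
      by (simp add: vec_eq_iff)
    moreover have "det R \<noteq> 0"
      using detR by auto
    ultimately show ?thesis
      using cramer[of R "column l (map_matrix real_of_int G)" "axis l 1"] by blast
  qed
  then have RG: "R ** map_matrix real_of_int G = mat 1"
    by (simp add: vec_eq_iff matrix_matrix_mult_def matrix_vector_mult_def column_def axis_def mat_def)
  then have GR: "map_matrix real_of_int G ** R = mat 1"
    by (simp add: matrix_left_right_inverse)
  have inj: "A = B" if "map_matrix real_of_int A = map_matrix real_of_int B" for A B :: "int^'n^'n"
    using that by (simp add: vec_eq_iff)
  show thesis
  proof
    show "H ** G = mat 1" using RG by (intro inj) (simp add: map_matrix_of_int_mult map_matrix_of_int_one R_def)
    show "G ** H = mat 1" using GR by (intro inj) (simp add: map_matrix_of_int_mult map_matrix_of_int_one R_def)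
  qed
qed

section \<open>Conjugacy of torus maps\<close>

lemma topologically_conjugate_iff_integrally_similar:
  fixes A B :: "int^'n::finite^'n"
  shows "topologically_conjugate (torus_map A) (torus_map B) \<longleftrightarrow> integrally_similar A B"
proof
  assume "topologically_conjugate (torus_map A) (torus_map B)"
  then obtain h h' where hom: "homeomorphism UNIV UNIV h h'"
    and conj: "h \<circ> torus_map A = torus_map B \<circ> h"
    unfolding topologically_conjugate_def by blast
  have cont: "continuous_on UNIV h" "continuous_on UNIV h'" and inv: "h \<circ> h' = torus_map (mat 1)"
    using hom by (auto simp: homeomorphism_def fun_eq_iff torus_map_one)
  obtain N where N: "induces_on_lattice h N"
    using cont(1) by (rule induces_on_lattice_exists)
  obtain N' where N': "induces_on_lattice h' N'"
    using cont(2) by (rule induces_on_lattice_exists)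
  have "N ** N' = mat 1"
    using induces_on_lattice_comp[OF N N'] induces_on_lattice_torus_map[of "mat 1"]
    unfolding inv by (rule induces_on_lattice_unique)
  then have "det N * det N' = 1"
    by (metis det_mul det_I)
  then have "det N = 1 \<or> det N = - 1"
    using zmult_eq_1_iff by blast
  moreover have "N ** A = B ** N"
    using induces_on_lattice_comp[OF N induces_on_lattice_torus_map[of A]]
      induces_on_lattice_comp[OF induces_on_lattice_torus_map[of B] N]
    unfolding conj by (rule induces_on_lattice_unique)
  ultimately show "integrally_similar A B"
    unfolding integrally_similar_def by blast
next
  assume "integrally_similar A B"
  then obtain H where H: "det H = 1 \<or> det H = - 1" "H ** A = B ** H"
    unfolding integrally_similar_def by blast
  obtain G where G: "H ** G = mat 1" "G ** H = mat 1"
    using int_matrix_unimodular_inverse[OF H(1)] .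
  have "homeomorphism UNIV UNIV (torus_map H) (torus_map G)"
    by (rule homeomorphismI)
       (auto simp: continuous_on_torus_map G torus_map_one simp flip: torus_map_mult)
  moreover have "torus_map H \<circ> torus_map A = torus_map B \<circ> torus_map H"
    by (simp add: fun_eq_iff H(2) flip: torus_map_mult)
  ultimately show "topologically_conjugate (torus_map A) (torus_map B)"
    unfolding topologically_conjugate_def by blast
qed

theorem theorem5p1:
  fixes A B :: "int^6^6"
  assumes "\<exists>J. symplectic_wrt J A" and "\<exists>J. symplectic_wrt J B"
    and "simple_eigenvalues A" and "simple_eigenvalues B"
    and "two_two_two_spectrum A" and "two_two_two_spectrum B"
    and "topologically_transitive (torus_map A)"
    and "topologically_transitive (torus_map B)"
  shows "topologically_conjugate (torus_map A) (torus_map B) \<longleftrightarrow> integrally_similar A B"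
  by (rule topologically_conjugate_iff_integrally_similar)

end
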